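(* For all integers $d,k,n\ge1$, $$\sum_{i=0}^{d-1}(i+1)\binom{d+k-i+n-2}{n-2}=(d+k+n)\left[\binom{d+k+n-1}{n-1}-\binom{k+n-1}{n-1}\right]-(n-1)\left[\binom{d+k+n}{n}-\binom{k+n}{n}\right].$$
   Context: Binomial coefficients are the usual ones, with the convention $\binom{m}{r}=0$ for $r<0$ (relevant only when $n=1$). *)

theory Defs
  imports Complex_Main
begin

text \<open>Binomial coefficient with integer arguments, with the convention that it vanishes
  for a negative lower index. It is the usual coefficient for upper index \<open>m \<ge> 0\<close>;
  for \<open>m < 0\<close>, \<open>nat\<close> truncates \<open>m\<close> to 0, so the value is not meaningful there.\<close>

definition binom :: "int \<Rightarrow> int \<Rightarrow> int" where
  "binom m r = (if r < 0 then 0 else int (nat m choose nat r))"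

lemma binom_of_nat: "binom (int m) (int r) = int (m choose r)"
  by (simp add: binom_def)

lemma binom_neg: "r < 0 \<Longrightarrow> binom m r = 0"
  by (simp add: binom_def)

end

theory Submission
  imports Defs
begin

text \<open>Write \<open>N = d + k + n\<close>. The weight \<open>i + 1\<close> is the difference between \<open>N\<close> and
  \<open>d + k - i + n - 1\<close>, and the latter is exactly one more than the upper index of the
  binomial coefficient it multiplies. The absorption identity (\<open>binom_absorption\<close>) therefore
  turns the subtracted part into \<open>n - 1\<close> times a coefficient with both indices raised by one, so
  no weight depending on \<open>i\<close> is left. What remains are two plain sums of binomial coefficients
  along a column of Pascal's triangle, with lower indices \<open>n - 2\<close> and \<open>n - 1\<close>; the
  hockey-stick identity (\<open>sum_binom_column\<close>) evaluates them, and they are the two brackets on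
  the right-hand side.

  With the convention that negative lower indices give 0, Pascal's rule and absorption hold for
  every integer lower index, so \<open>n = 1\<close> is an instance of the same computation.\<close>

lemma binom_Pascal:
  assumes "m \<ge> 0"
  shows "binom (m + 1) (r + 1) = binom m r + binom m (r + 1)"
proof -
  consider "r < -1" | "r = -1" | "r \<ge> 0" by linarith
  then show ?thesis
    using assms by cases (simp_all add: binom_def nat_add_distrib)
qed

lemma binom_absorption:
  assumes "m \<ge> 0"
  shows "(m + 1) * binom m r = (r + 1) * binom (m + 1) (r + 1)"
proof -
  consider "r < -1" | "r = -1" | "r \<ge> 0" by linarith
  then show ?thesis
  proof cases
    case 3
    obtain a b where [simp]: "m = int a" "r = int b"
      using assms 3 by (metis nonneg_int_cases)
    have "int (Suc b * (Suc a choose Suc b)) = int (Suc a * (a choose b))"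
      by (simp only: Suc_times_binomial)
    then show ?thesis
      by (simp add: binom_def nat_add_distrib algebra_simps)
  qed (simp_all add: binom_def)
qed

text \<open>The hockey-stick identity over a segment of a column: by Pascal's rule each summand is a
  difference of neighbouring entries of the next column, so the sum telescopes.\<close>

lemma sum_binom_column:
  assumes "a \<ge> 0" and "d \<ge> 0"
  shows "(\<Sum>i = 0..d - 1. binom (a + d - i - 1) r) = binom (a + d) (r + 1) - binom a (r + 1)"
proof -
  \<comment> \<open>The number of summands has to vary independently of the upper index at which they start.\<close>
  have "(\<Sum>i = 0..e - 1. binom (a + d - i - 1) r)
      = binom (a + d) (r + 1) - binom (a + d - e) (r + 1)" if "e \<ge> 0" "e \<le> d" for e
    using that
  proof (induction e rule: int_ge_induct)
    case base
    then show ?case by simp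
  next
    case (step e)
    have "{0..e + 1 - 1} = insert e {0..e - 1}"
      using step.hyps by auto
    moreover have "binom (a + d - e) (r + 1)
        = binom (a + d - e - 1) r + binom (a + d - e - 1) (r + 1)"
      using binom_Pascal[of "a + d - e - 1" r] assms step.prems by simp
    ultimately show ?case
      using step by (simp add: algebra_simps)
  qed
  from this[of d] show ?thesis
    using assms by simp
qed

theorem lemma5p2:
  fixes d k n :: int
  assumes "d \<ge> 1" and "k \<ge> 1" and "n \<ge> 1"
  shows "(\<Sum>i = 0..d - 1. (i + 1) * binom (d + k - i + n - 2) (n - 2))
    = (d + k + n) * (binom (d + k + n - 1) (n - 1) - binom (k + n - 1) (n - 1))
      - (n - 1) * (binom (d + k + n) n - binom (k + n) n)"
proof -
  have "(i + 1) * binom (d + k - i + n - 2) (n - 2)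
      = (d + k + n) * binom ((k + n - 1) + d - i - 1) (n - 2)
        - (n - 1) * binom ((k + n) + d - i - 1) (n - 1)" if "i \<in> {0..d - 1}" for i
  proof -
    let ?m = "d + k - i + n - 2"
    have "(?m + 1) * binom ?m (n - 2) = (n - 1) * binom (?m + 1) (n - 1)"
      using binom_absorption[of ?m "n - 2"] assms that by simp
    moreover have "i + 1 = (d + k + n) - (?m + 1)"
      by simp
    moreover have "(k + n - 1) + d - i - 1 = ?m" "(k + n) + d - i - 1 = ?m + 1"
      by simp_all
    ultimately show ?thesis
      by (simp only: left_diff_distrib)
  qed
  then have "(\<Sum>i = 0..d - 1. (i + 1) * binom (d + k - i + n - 2) (n - 2))
      = (d + k + n) * (\<Sum>i = 0..d - 1. binom ((k + n - 1) + d - i - 1) (n - 2))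
        - (n - 1) * (\<Sum>i = 0..d - 1. binom ((k + n) + d - i - 1) (n - 1))"
    by (simp add: sum_subtractf sum_distrib_left)
  also have "(\<Sum>i = 0..d - 1. binom ((k + n - 1) + d - i - 1) (n - 2))
      = binom (d + k + n - 1) (n - 1) - binom (k + n - 1) (n - 1)"
    using sum_binom_column[of "k + n - 1" d "n - 2"] assms by (simp add: algebra_simps)
  also have "(\<Sum>i = 0..d - 1. binom ((k + n) + d - i - 1) (n - 1))
      = binom (d + k + n) n - binom (k + n) n"
    using sum_binom_column[of "k + n" d "n - 1"] assms by (simp add: algebra_simps)
  finally show ?thesis .
qed

end
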